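(* For a real number $\lambda\ge 0$ define $$S_\lambda=\sum_{n\ge 0}\frac{[n^\lambda]}{n!},$$ where the $n=0$ term is taken to be $0$ for every $\lambda\geq 0$. Then the function $[0,\infty)\to\mathbb{R}$, $\lambda\mapsto S_\lambda$, is injective, monotone, and continuous from the right. Its image $\{S_\lambda:\lambda\ge 0\}\subset\mathbb{R}$ has the cardinality of the continuum, has Hausdorff dimension $0$, and is totally disconnected.
   Context: $[x]$ denotes the integer part (floor) of the real number $x$. The convention $0^\lambda=0$ is used for all $\lambda\ge 0$, including $\lambda=0$, so that $S_\lambda=\sum_{n\ge1}[n^\lambda]/n!$. *)

theory Defs
  imports "HOL-Analysis.Analysis" "HOL-Real_Asymp.Real_Asymp"
begin

(* 0 powr l = 0 for every l, including l = 0, so the term for n = 0 vanishes. *)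
definition S :: "real \<Rightarrow> real" where
  "S l = (\<Sum>n. real_of_int \<lfloor>real n powr l\<rfloor> / fact n)"

lemma summable_S: "summable (\<lambda>n. real_of_int \<lfloor>real n powr l\<rfloor> / fact n)"
proof (rule summable_comparison_test_ev)
  have "eventually (\<lambda>n::nat. real n powr l \<le> 2 ^ n) sequentially"
    by real_asymp
  then show "eventually (\<lambda>n. norm (real_of_int \<lfloor>real n powr l\<rfloor> / fact n) \<le> 2 ^ n / fact n) sequentially"
  proof eventually_elim
    case (elim n)
    have "real_of_int \<lfloor>real n powr l\<rfloor> \<le> 2 ^ n"
      using elim of_int_floor_le[of "real n powr l"] by linarith
    then show ?case by (simp add: divide_right_mono)
  qed
  show "summable (\<lambda>n. (2::real) ^ n / fact n)"
    using summable_exp[of "2::real"] by (simp add: field_simps)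
qed

(* The s-th power of the diameter, with the usual conventions diam({})^s = 0 for all s and
   diam(U)^0 = 1 for nonempty U; the latter needs a separate case because 0 powr 0 = 0. *)
definition diam_powr :: "real \<Rightarrow> 'a::metric_space set \<Rightarrow> ennreal" where
  "diam_powr s U = (if U = {} then 0 else if s = 0 then 1 else ennreal (diameter U powr s))"

(* Boundedness is required because diameter is real-valued and hence meaningless on unbounded
   sets. Finite covers are included by padding with empty sets. *)
definition hausdorff_premeasure :: "real \<Rightarrow> real \<Rightarrow> 'a::metric_space set \<Rightarrow> ennreal" where
  "hausdorff_premeasure s \<delta> A =
     (INF U \<in> {U :: nat \<Rightarrow> 'a set. A \<subseteq> (\<Union>i. U i) \<and> (\<forall>i. bounded (U i) \<and> diameter (U i) \<le> \<delta>)}.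
        \<Sum>i. diam_powr s (U i))"

definition hausdorff_measure :: "real \<Rightarrow> 'a::metric_space set \<Rightarrow> ennreal" where
  "hausdorff_measure s A = (SUP \<delta> \<in> {0<..}. hausdorff_premeasure s \<delta> A)"

definition hausdorff_dim :: "'a::metric_space set \<Rightarrow> ennreal" where
  "hausdorff_dim A = (INF s \<in> {s. 0 \<le> s \<and> hausdorff_measure s A = 0}. ennreal s)"

definition totally_disconnected :: "'a::topological_space set \<Rightarrow> bool" where
  "totally_disconnected A \<longleftrightarrow> (\<forall>C. C \<subseteq> A \<and> connected C \<longrightarrow> (\<forall>x\<in>C. \<forall>y\<in>C. x = y))"

end

(* On a set of l in [0, L] on which the integers [n^l], n < N, are constant, S varies by at most the
   tail of the sum of n^L / n! beyond N, which is O(c^(-N)) for every c, whereas only polynomially many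
   (in N) tuples of such integers occur. Hence S ` [0, L] has Hausdorff measure 0 in every positive
   dimension, and right continuity of S follows from that of [n^l] for n < N. Moreover, when n^l is an
   integer, S jumps at l by at least 1 / n! from the left; such l are dense, so the image of S contains
   no interval. *)
theory Submission
  imports Defs
begin

section \<open>Upper bounds for Hausdorff premeasures, obtained from explicit covers\<close>

section \<open>Hausdorff measure\<close>

lemma hausdorff_premeasure_le:
  assumes "A \<subseteq> (\<Union>i. U i)" "\<And>i. bounded (U i)" "\<And>i. diameter (U i) \<le> \<delta>"
  shows "hausdorff_premeasure s \<delta> A \<le> (\<Sum>i. diam_powr s (U i))"
  unfolding hausdorff_premeasure_def using assms by (intro INF_lower) auto

text \<open>Reduces a dimension estimate to counting: \<open>M + 1\<close> pieces of diameter at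
  most \<open>d\<close> cost at most \<open>d powr s\<close> each. The finite cover is padded with
  empty sets, which \<open>diam_powr\<close> counts as 0.\<close>

lemma hausdorff_premeasure_le_finite_cover:
  fixes U :: "nat \<Rightarrow> 'a::metric_space set"
  assumes "s > 0" "0 \<le> d" "d \<le> \<delta>" and cover: "A \<subseteq> (\<Union>i\<in>{..M}. U i)"
    and bdd: "\<And>i. bounded (U i)" and diam: "\<And>i. diameter (U i) \<le> d"
  shows "hausdorff_premeasure s \<delta> A \<le> ennreal ((real M + 1) * d powr s)"
proof -
  define V where "V i = (if i \<le> M then U i else {})" for i
  have "hausdorff_premeasure s \<delta> A \<le> (\<Sum>i. diam_powr s (V i))"
  proof (rule hausdorff_premeasure_le)
    show "A \<subseteq> (\<Union>i. V i)" using cover by (fastforce simp: V_def)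
    show "bounded (V i)" for i using bdd by (auto simp: V_def)
    show "diameter (V i) \<le> \<delta>" for i
      using diam[of i] assms(2,3) by (auto simp: V_def)
  qed
  also have "\<dots> = (\<Sum>i\<le>M. diam_powr s (V i))"
    by (rule suminf_finite) (auto simp: V_def diam_powr_def)
  also have "\<dots> \<le> (\<Sum>i\<le>M. ennreal (d powr s))"
  proof (rule sum_mono)
    fix i
    have "diameter (U i) powr s \<le> d powr s"
      using assms(1) diam[of i] diameter_ge_0[OF bdd[of i]] by (intro powr_mono2) auto
    then show "diam_powr s (V i) \<le> ennreal (d powr s)"
      using assms(1) by (auto simp: diam_powr_def V_def intro: ennreal_leI)
  qed
  also have "\<dots> = ennreal ((real M + 1) * d powr s)"
    by (simp add: ennreal_mult'' ennreal_of_nat_eq_real_of_nat add.commute flip: ennreal_plus)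
  finally show ?thesis .
qed

text \<open>The usual countable subadditivity argument: cover the \<open>k\<close>-th set at cost
  below \<open>e / 2 ^ (k + 1)\<close> and merge the covers. Keeping \<open>\<delta>\<close> fixed
  lets the supremum over \<open>\<delta>\<close> wait until the end.\<close>

lemma hausdorff_premeasure_UN_eq_0:
  fixes A :: "nat \<Rightarrow> 'a::metric_space set"
  assumes null: "\<And>k. hausdorff_premeasure s \<delta> (A k) = 0"
  shows "hausdorff_premeasure s \<delta> (\<Union>k. A k) = 0"
proof -
  have "hausdorff_premeasure s \<delta> (\<Union>k. A k) \<le> ennreal e" if "e > 0" for e
  proof -
    have "\<exists>U. A k \<subseteq> (\<Union>i. U i) \<and> (\<forall>i. bounded (U i) \<and> diameter (U i) \<le> \<delta>)
            \<and> (\<Sum>i. diam_powr s (U i)) < ennreal (e * (1/2) ^ Suc k)" for k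
    proof -
      have "hausdorff_premeasure s \<delta> (A k) < ennreal (e * (1/2) ^ Suc k)"
        using \<open>e > 0\<close> unfolding null by (simp add: ennreal_zero_less_mult_iff)
      then show ?thesis
        unfolding hausdorff_premeasure_def INF_less_iff by auto
    qed
    then obtain U where U: "\<And>k. A k \<subseteq> (\<Union>i. U k i)"
        "\<And>k i. bounded (U k i)" "\<And>k i. diameter (U k i) \<le> \<delta>"
        "\<And>k. (\<Sum>i. diam_powr s (U k i)) < ennreal (e * (1/2) ^ Suc k)"
      by metis
    \<comment> \<open>The doubly indexed family of covers is flattened to a sequence by the pairing
      bijection.\<close>
    define V where "V j = (case prod_decode j of (k, i) \<Rightarrow> U k i)" for j
    have "hausdorff_premeasure s \<delta> (\<Union>k. A k) \<le> (\<Sum>j. diam_powr s (V j))"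
    proof (rule hausdorff_premeasure_le)
      show "(\<Union>k. A k) \<subseteq> (\<Union>j. V j)"
      proof
        fix x assume "x \<in> (\<Union>k. A k)"
        then obtain k i where "x \<in> U k i" using U(1) by blast
        then have "x \<in> V (prod_encode (k, i))" by (simp add: V_def)
        then show "x \<in> (\<Union>j. V j)" by blast
      qed
    qed (auto simp: V_def U split: prod.split)
    also have "\<dots> = (\<Sum>j. (\<lambda>(k, i). diam_powr s (U k i)) (prod_decode j))"
      by (simp add: V_def split_def)
    also have "\<dots> = (\<Sum>k. \<Sum>i. diam_powr s (U k i))"
      by (rule suminf_ennreal_2dimen) simp
    also have "\<dots> \<le> (\<Sum>k. ennreal (e * (1/2) ^ Suc k))"
      using U(4) by (intro suminf_le) (auto intro: less_imp_le)
    also have "\<dots> = ennreal e"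
    proof (rule suminf_ennreal_eq)
      show "0 \<le> e * (1/2) ^ Suc k" for k using \<open>e > 0\<close> by simp
      show "(\<lambda>k. e * (1/2) ^ Suc k) sums e"
        using sums_mult[OF power_half_series, of e] by simp
    qed
    finally show ?thesis .
  qed
  then have "hausdorff_premeasure s \<delta> (\<Union>k. A k) \<le> 0"
    by - (rule ennreal_le_epsilon, auto)
  then show ?thesis by simp
qed

lemma hausdorff_dim_eq_0:
  assumes "\<And>s. s > 0 \<Longrightarrow> hausdorff_measure s A = 0"
  shows "hausdorff_dim A = 0"
proof -
  have "hausdorff_dim A \<le> ennreal s" if "s > 0" for s
    unfolding hausdorff_dim_def using assms that by (intro INF_lower) auto
  then have "hausdorff_dim A \<le> 0"
    by - (rule ennreal_le_epsilon, auto)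
  then show ?thesis by simp
qed

section \<open>Monotonicity, jumps and right continuity of \<open>S\<close>\<close>

section \<open>Variation of \<open>S\<close>\<close>

lemma powr_nat_mono: "l \<le> m \<Longrightarrow> real n powr l \<le> real n powr m"
  by (cases "n = 0") (auto intro: powr_mono)

lemma floor_powr_nat_mono: "l \<le> m \<Longrightarrow> \<lfloor>real n powr l\<rfloor> \<le> \<lfloor>real n powr m\<rfloor>"
  by (intro floor_mono powr_nat_mono)

lemma S_mono: "l \<le> m \<Longrightarrow> S l \<le> S m"
  unfolding S_def
  by (intro suminf_le summable_S divide_right_mono) (auto intro: floor_powr_nat_mono)

text \<open>The series for \<open>S m - S l\<close> has nonnegative terms, so it is at least its
  \<open>n\<close>-th term; there the floors are distinct integers and differ by at least 1.\<close>

lemma S_jump: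
  assumes "l \<le> m" "\<lfloor>real n powr l\<rfloor> < \<lfloor>real n powr m\<rfloor>"
  shows "S l + 1 / fact n \<le> S m"
proof -
  let ?d = "\<lambda>k. real_of_int \<lfloor>real k powr m\<rfloor> / fact k - real_of_int \<lfloor>real k powr l\<rfloor> / fact k"
  have "1 / fact n \<le> ?d n"
    using assms(2) by (simp add: divide_right_mono flip: diff_divide_distrib)
  also have "\<dots> = sum ?d {n}" by simp
  also have "\<dots> \<le> suminf ?d"
    using floor_powr_nat_mono[OF assms(1)]
    by (intro sum_le_suminf summable_diff summable_S) (auto intro: divide_right_mono)
  also have "\<dots> = S m - S l"
    unfolding S_def by (intro suminf_diff[symmetric] summable_S)
  finally show ?thesis by simp
qed

text \<open>Terms with \<open>n < N\<close> cancel. In the tail, a factor \<open>c ^ (n - N)\<close>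
  is inserted, which bounds it by \<open>c ^ (-N)\<close> times a convergent series. That series
  serves as \<open>K\<close>, so \<open>K\<close> depends only on \<open>c\<close> and
  \<open>L\<close>. The freedom in \<open>c\<close> is what later handles every positive
  dimension.\<close>

lemma S_variation_bound:
  fixes c L :: real
  assumes "c \<ge> 1"
  obtains K where "K > 0"
    "\<And>N l m. \<lbrakk>l \<le> m; m \<le> L; \<forall>n<N. \<lfloor>real n powr l\<rfloor> = \<lfloor>real n powr m\<rfloor>\<rbrakk> \<Longrightarrow> S m - S l \<le> K / c ^ N"
proof -
  let ?g = "\<lambda>n. c ^ n * real n powr L / fact n"
  have summ: "summable ?g"
  proof (rule summable_comparison_test_ev)
    have "eventually (\<lambda>n::nat. real n powr L \<le> 2 ^ n) sequentially"
      by real_asymp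
    then show "eventually (\<lambda>n. norm (?g n) \<le> (2 * c) ^ n / fact n) sequentially"
    proof eventually_elim
      case (elim n)
      then show ?case
        using assms by (simp add: power_mult_distrib divide_right_mono mult.commute mult_right_mono)
    qed
    show "summable (\<lambda>n. (2 * c) ^ n / fact n)"
      using summable_exp[of "2 * c"] by (simp add: field_simps)
  qed
  have g0: "?g n \<ge> 0" for n using assms by simp
  show ?thesis
  proof (rule that)
    show "suminf ?g > 0"
      \<comment> \<open>The term at \<open>n = 1\<close> equals \<open>c > 0\<close>.\<close>
      using summ g0 by (rule suminf_pos2[where i = 1]) (use assms in auto)
    fix N and l m :: real
    assume lm: "l \<le> m" "m \<le> L" and eq: "\<forall>n<N. \<lfloor>real n powr l\<rfloor> = \<lfloor>real n powr m\<rfloor>"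
    have "S m - S l = (\<Sum>n. real_of_int \<lfloor>real n powr m\<rfloor> / fact n - real_of_int \<lfloor>real n powr l\<rfloor> / fact n)"
      unfolding S_def by (intro suminf_diff summable_S)
    also have "\<dots> \<le> (\<Sum>n. ?g n / c ^ N)"
    proof (intro suminf_le summable_diff summable_S summable_divide summ)
      fix n
      show "real_of_int \<lfloor>real n powr m\<rfloor> / fact n - real_of_int \<lfloor>real n powr l\<rfloor> / fact n \<le> ?g n / c ^ N"
      proof (cases "n < N")
        case True
        then show ?thesis using eq assms by simp
      next
        case False
        have "real_of_int \<lfloor>real n powr m\<rfloor> - real_of_int \<lfloor>real n powr l\<rfloor> \<le> real n powr m"
          using of_int_floor_le[of "real n powr m"] by (smt (verit) of_int_0_le_iff powr_ge_zero zero_le_floor)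
        also have "\<dots> \<le> 1 * real n powr L"
          using powr_nat_mono[OF lm(2)] by simp
        also have "\<dots> \<le> (c ^ n / c ^ N) * real n powr L"
          using False assms by (intro mult_right_mono) (auto simp: power_increasing)
        finally have "(real_of_int \<lfloor>real n powr m\<rfloor> - real_of_int \<lfloor>real n powr l\<rfloor>) / fact n
            \<le> c ^ n / c ^ N * real n powr L / fact n"
          by (rule divide_right_mono) simp
        then show ?thesis by (simp add: diff_divide_distrib mult.commute)
      qed
    qed
    also have "\<dots> = suminf ?g / c ^ N"
      by (intro suminf_divide summ)
    finally show "S m - S l \<le> suminf ?g / c ^ N" .
  qed
qed

lemma S_right_continuous: "continuous (at_right l) S"
  unfolding continuous_within
proof (rule tendstoI)
  fix e :: real assume "e > 0"
  obtain K where "K > 0" and K: "\<And>N l' m. \<lbrakk>l' \<le> m; m \<le> l + 1;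
      \<forall>n<N. \<lfloor>real n powr l'\<rfloor> = \<lfloor>real n powr m\<rfloor>\<rbrakk> \<Longrightarrow> S m - S l' \<le> K / 2 ^ N"
    using S_variation_bound[of 2 "l + 1"] by auto
  have "(\<lambda>N. K / 2 ^ N) \<longlonglongrightarrow> 0" by real_asymp
  then have "eventually (\<lambda>N. K / 2 ^ N < e) sequentially"
    using \<open>e > 0\<close> by (rule order_tendstoD)
  then obtain N where N: "K / 2 ^ N < e"
    by (auto simp: eventually_sequentially)
  \<comment> \<open>Just to the right of \<open>l\<close> the power stays below the next integer,
    and monotonicity in the exponent excludes smaller floors. For \<open>n = 0\<close> the power is
    constantly 0.\<close>
  have "\<forall>\<^sub>F m in at_right l. \<lfloor>real n powr l\<rfloor> = \<lfloor>real n powr m\<rfloor>" for n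
  proof (cases "n = 0")
    case False
    have "((\<lambda>m. real n powr m) \<longlongrightarrow> real n powr l) (at_right l)"
      using False by (intro tendsto_intros) auto
    moreover have "real n powr l < real_of_int \<lfloor>real n powr l\<rfloor> + 1" by linarith
    ultimately have "\<forall>\<^sub>F m in at_right l. real n powr m < real_of_int \<lfloor>real n powr l\<rfloor> + 1"
      by (rule order_tendstoD)
    with eventually_at_right_less[of l] show ?thesis
    proof eventually_elim
      case (elim m)
      then show ?case using floor_powr_nat_mono[of l m n] by linarith
    qed
  qed auto
  then have "\<forall>\<^sub>F m in at_right l. \<forall>n\<in>{..<N}. \<lfloor>real n powr l\<rfloor> = \<lfloor>real n powr m\<rfloor>"
    by (intro eventually_ball_finite) auto
  moreover have "\<forall>\<^sub>F m in at_right l. m < l + 1"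
    by (intro order_tendstoD[OF tendsto_ident_at]) auto
  ultimately show "\<forall>\<^sub>F m in at_right l. dist (S m) (S l) < e"
    using eventually_at_right_less[of l]
  proof eventually_elim
    case (elim m)
    then have "S m - S l \<le> K / 2 ^ N" by (intro K) auto
    then show ?case using N S_mono[of l m] elim by (simp add: dist_real_def)
  qed
qed

text \<open>For large \<open>n\<close> the factor \<open>n powr (m - l)\<close> is at least 2, and
  \<open>n powr l \<ge> 1\<close> since \<open>l \<ge> 0\<close>, so doubling adds at least 1. A
  difference of 1 forces the floors apart; \<open>n \<ge> 2\<close> makes \<open>n\<close> usable as
  a base of logarithms.\<close>

lemma powr_nat_gap:
  fixes l m :: real
  assumes "0 \<le> l" "l < m"
  obtains n where "n \<ge> 2" "real n powr l + 1 \<le> real n powr m"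
proof -
  have "m - l > 0" using assms by simp
  then have "eventually (\<lambda>n::nat. real n powr (m - l) \<ge> 2) sequentially" by real_asymp
  then have "eventually (\<lambda>n::nat. n \<ge> 2 \<and> real n powr (m - l) \<ge> 2) sequentially"
    using eventually_ge_at_top by (rule eventually_conj[rotated])
  then obtain n :: nat where n: "n \<ge> 2" "real n powr (m - l) \<ge> 2"
    by (auto simp: eventually_sequentially)
  have "real n powr l \<ge> 1"
    using n assms by (intro ge_one_powr_ge_zero) auto
  then have "real n powr l + 1 \<le> real n powr l * 2" by simp
  also have "\<dots> \<le> real n powr l * real n powr (m - l)"
    using n by (intro mult_left_mono) auto
  also have "\<dots> = real n powr m" by (simp flip: powr_add)
  finally show ?thesis using n that by blast
qed

lemma S_strict_mono:
  assumes "0 \<le> l" "l < m"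
  shows "S l < S m"
proof -
  obtain n where "real n powr l + 1 \<le> real n powr m"
    using powr_nat_gap[OF assms] by blast
  then have "\<lfloor>real n powr l\<rfloor> < \<lfloor>real n powr m\<rfloor>" by linarith
  then have "S l + 1 / fact n \<le> S m" using assms by (intro S_jump) auto
  moreover have "(1 :: real) / fact n > 0" by simp
  ultimately show ?thesis by linarith
qed

section \<open>Total disconnectedness, Hausdorff dimension and cardinality of the image\<close>

section \<open>The image of \<open>S\<close>\<close>

text \<open>Some integer \<open>k\<close> lies in the interval from \<open>n powr l\<close>
  (excluded) to \<open>n powr m\<close> (included). At the exponent \<open>p\<close> with
  \<open>n powr p = k\<close> the \<open>n\<close>-th floor jumps, so \<open>S\<close> skips the
  values just below \<open>S p\<close>.\<close>

lemma S_image_gap: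
  assumes "0 \<le> l" "l < m"
  obtains x where "S l \<le> x" "x \<le> S m" "x \<notin> range S"
proof -
  obtain n where n: "n \<ge> 2" "real n powr l + 1 \<le> real n powr m"
    using powr_nat_gap[OF assms] by blast
  define k where "k = real_of_int \<lfloor>real n powr m\<rfloor>"
  have k: "real n powr l < k" "k \<le> real n powr m"
    unfolding k_def using n(2) by linarith+
  have "k > 0" using k(1) by (smt (verit) powr_ge_zero)
  define p where "p = log n k"
  have p: "real n powr p = k" using n \<open>k > 0\<close> by (simp add: p_def)
  have less_iff: "real n powr a < real n powr b \<longleftrightarrow> a < b" for a b
    using n(1) by simp
  have "l < p" "p \<le> m" using k less_iff unfolding p[symmetric] by (auto simp: not_less[symmetric])
  have jump: "S q + 1 / fact n \<le> S p" if "q < p" for q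
  proof (rule S_jump)
    have "real n powr q < k" using that less_iff p by metis
    then show "\<lfloor>real n powr q\<rfloor> < \<lfloor>real n powr p\<rfloor>"
      unfolding p unfolding k_def by (simp add: floor_less_iff)
  qed (use that in simp)
  define h :: real where "h = 1 / fact n"
  have "h > 0" by (simp add: h_def)
  \<comment> \<open>Exponents left of \<open>p\<close> give values at most \<open>S p - h\<close>,
    the others at least \<open>S p\<close>; the midpoint of this gap is missed.\<close>
  have "S q \<noteq> S p - h / 2" for q
  proof (cases "q < p")
    case True
    then show ?thesis using jump[of q] \<open>h > 0\<close> by (simp add: h_def[symmetric])
  next
    case False
    then show ?thesis using S_mono[of p q] \<open>h > 0\<close> by simp
  qed
  then have "S p - h / 2 \<notin> range S" by (metis imageE)
  moreover have "S l \<le> S p - h / 2"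
    using jump[OF \<open>l < p\<close>] \<open>h > 0\<close> by (simp add: h_def[symmetric])
  moreover have "S p - h / 2 \<le> S m"
    using S_mono[OF \<open>p \<le> m\<close>] \<open>h > 0\<close> by simp
  ultimately show ?thesis using that by blast
qed

text \<open>A connected set of reals contains everything between two of its points, hence with two
  distinct points it would contain a value that \<open>S\<close> skips.\<close>

lemma totally_disconnected_S_image: "totally_disconnected (S ` {0..})"
  unfolding totally_disconnected_def
proof (intro allI impI ballI)
  fix C x y assume C: "C \<subseteq> S ` {0..} \<and> connected C" and "x \<in> C" "y \<in> C"
  have no_less: "\<not> u < v" if uv: "u \<in> C" "v \<in> C" for u v
  proof
    assume "u < v"
    have "u \<in> S ` {0..}" "v \<in> S ` {0..}" using C uv by blast+
    then obtain l m where lm: "u = S l" "v = S m" "0 \<le> l" "0 \<le> m" by auto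
    then have "l < m" using \<open>u < v\<close> S_mono[of m l] by fastforce
    with lm obtain z where "u \<le> z" "z \<le> v" "z \<notin> range S"
      using S_image_gap[of l m] by blast
    moreover have "z \<in> C"
      using C uv \<open>u \<le> z\<close> \<open>z \<le> v\<close> connectedD_interval by blast
    ultimately show False using C by blast
  qed
  show "x = y" using no_less \<open>x \<in> C\<close> \<open>y \<in> C\<close> by (metis less_linear)
qed

text \<open>The image is split by the floors for \<open>n < N\<close>. There are polynomially many
  pieces in \<open>N\<close>, each contributing at most \<open>K powr s / 2 ^ N\<close>, so the
  total cost tends to 0.\<close>

lemma S_image_premeasure_eq_0:
  assumes "s > 0" "\<delta> > 0"
  shows "hausdorff_premeasure s \<delta> (S ` {0..real L}) = 0"
proof -
  \<comment> \<open>Chosen so that \<open>(c ^ N) powr s = 2 ^ N\<close>: even for small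
    \<open>s\<close> the pieces shrink exponentially after taking the \<open>s\<close>-th
    power.\<close>
  define c :: real where "c = 2 powr (1 / s)"
  have "c > 1" using assms unfolding c_def by (intro gr_one_powr) auto
  obtain K where "K > 0" and K: "\<And>N l m. \<lbrakk>l \<le> m; m \<le> real L;
      \<forall>n<N. \<lfloor>real n powr l\<rfloor> = \<lfloor>real n powr m\<rfloor>\<rbrakk> \<Longrightarrow> S m - S l \<le> K / c ^ N"
    using S_variation_bound[of c "real L"] \<open>c > 1\<close> by auto
  have powr_eq: "(K / c ^ N) powr s = K powr s / 2 ^ N" for N
  proof -
    have "(c ^ N) powr s = 2 ^ N"
      using assms \<open>c > 1\<close> by (simp add: c_def powr_powr powr_realpow[symmetric] mult.commute)
    then show ?thesis using \<open>K > 0\<close> \<open>c > 1\<close> by (simp add: powr_divide)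
  qed
  have bound: "hausdorff_premeasure s \<delta> (S ` {0..real L})
      \<le> ennreal ((real N * real N powr real L + 1) * (K powr s / 2 ^ N))" if "K / c ^ N \<le> \<delta>" for N
  proof -
    (* All summands are monotone in l, so this one number determines the whole tuple of floors. *)
    define P where "P l = (\<Sum>n<N. nat \<lfloor>real n powr l\<rfloor>)" for l
    have P_eq: "\<forall>n<N. \<lfloor>real n powr l\<rfloor> = \<lfloor>real n powr m\<rfloor>" if "l \<le> m" "P l = P m" for l m
    proof (rule ccontr)
      assume "\<not> ?thesis"
      then obtain n where "n < N" "\<lfloor>real n powr l\<rfloor> \<noteq> \<lfloor>real n powr m\<rfloor>" by blast
      then have "nat \<lfloor>real n powr l\<rfloor> < nat \<lfloor>real n powr m\<rfloor>"
        using floor_powr_nat_mono[OF \<open>l \<le> m\<close>, of n] by (subst nat_less_eq_zless) auto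
      then have "P l < P m"
        unfolding P_def using \<open>n < N\<close> floor_powr_nat_mono[OF \<open>l \<le> m\<close>]
        by (intro sum_strict_mono_ex1) (auto intro: nat_mono)
      then show False using that by simp
    qed
    define U where "U k = S ` {l \<in> {0..real L}. P l = k}" for k
    have U_dist: "norm (x - y) \<le> K / c ^ N" if xy: "x \<in> U k" "y \<in> U k" for x y k
    proof -
      obtain l m where lm: "x = S l" "y = S m" "l \<le> real L" "m \<le> real L" "P l = P m"
        using xy by (auto simp: U_def)
      show ?thesis
      proof (cases "l \<le> m")
        case True
        then show ?thesis
          using K[of l m N] P_eq[of l m] S_mono[of l m] lm by auto
      next
        case False
        then show ?thesis
          using K[of m l N] P_eq[of m l] S_mono[of m l] lm by auto
      qed
    qed
    \<comment> \<open>\<open>P l\<close> adds \<open>N\<close> floors, each at most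
      \<open>N powr L\<close>, so at most \<open>M + 1\<close> values of \<open>P\<close>
      occur.\<close>
    define M where "M = nat \<lfloor>real N * real N powr real L\<rfloor>"
    have P_le: "P l \<le> M" if "l \<le> real L" for l
    proof -
      have "real (P l) = (\<Sum>n<N. real (nat \<lfloor>real n powr l\<rfloor>))" by (simp add: P_def)
      also have "\<dots> \<le> (\<Sum>n<N. real N powr real L)"
      proof (rule sum_mono)
        fix n assume "n \<in> {..<N}"
        have "real (nat \<lfloor>real n powr l\<rfloor>) \<le> real n powr l" by simp
        also have "\<dots> \<le> real n powr real L" by (rule powr_nat_mono) fact
        also have "\<dots> \<le> real N powr real L" using \<open>n \<in> _\<close> by (intro powr_mono2) auto
        finally show "real (nat \<lfloor>real n powr l\<rfloor>) \<le> real N powr real L" .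
      qed
      finally have "real (P l) \<le> real N * real N powr real L" by simp
      then show ?thesis unfolding M_def by linarith
    qed
    have "hausdorff_premeasure s \<delta> (S ` {0..real L}) \<le> ennreal ((real M + 1) * (K / c ^ N) powr s)"
    proof (rule hausdorff_premeasure_le_finite_cover)
      show "S ` {0..real L} \<subseteq> (\<Union>k\<in>{..M}. U k)"
      proof (intro image_subsetI UN_I)
        fix l assume "l \<in> {0..real L}"
        then show "P l \<in> {..M}" "S l \<in> U (P l)" using P_le by (auto simp: U_def)
      qed
      show "diameter (U k) \<le> K / c ^ N" for k
        using U_dist \<open>K > 0\<close> \<open>c > 1\<close> by (intro diameter_le) auto
      show "bounded (U k)" for k
        unfolding bounded_two_points using U_dist[of _ k] by (metis dist_norm)
    qed (use assms that \<open>K > 0\<close> \<open>c > 1\<close> in auto)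
    also have "\<dots> \<le> ennreal ((real N * real N powr real L + 1) * (K powr s / 2 ^ N))"
      unfolding powr_eq by (intro ennreal_leI mult_right_mono) (auto simp: M_def)
    finally show ?thesis .
  qed
  have "(\<lambda>N. K / c ^ N) \<longlonglongrightarrow> 0" using \<open>c > 1\<close> by real_asymp
  then have "eventually (\<lambda>N. K / c ^ N < \<delta>) sequentially"
    using \<open>\<delta> > 0\<close> by (rule order_tendstoD)
  then have ev: "eventually (\<lambda>N. hausdorff_premeasure s \<delta> (S ` {0..real L})
      \<le> ennreal ((real N * real N powr real L + 1) * (K powr s / 2 ^ N))) sequentially"
    by eventually_elim (rule bound, simp)
  have "(\<lambda>N. (real N * real N powr real L + 1) * (K powr s / 2 ^ N)) \<longlonglongrightarrow> 0"
    by real_asymp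
  then have "(\<lambda>N. ennreal ((real N * real N powr real L + 1) * (K powr s / 2 ^ N))) \<longlonglongrightarrow> ennreal 0"
    by (rule tendsto_ennrealI)
  then have "hausdorff_premeasure s \<delta> (S ` {0..real L}) \<le> ennreal 0"
    using ev by (rule tendsto_lowerbound) simp
  then show ?thesis by simp
qed

text \<open>The variation bound requires bounded exponents, so \<open>{0..}\<close> is exhausted by
  the intervals \<open>{0..real L}\<close> and the null premeasures are combined for each
  \<open>\<delta>\<close>.\<close>

lemma hausdorff_dim_S_image: "hausdorff_dim (S ` {0..}) = 0"
proof (rule hausdorff_dim_eq_0)
  fix s :: real assume "s > 0"
  have "{0..} = (\<Union>L. {0..real L})" using real_arch_simple by fastforce
  then have "S ` {0..} = (\<Union>L. S ` {0..real L})" by (metis image_UN)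
  then have "hausdorff_premeasure s \<delta> (S ` {0..}) = 0" if "\<delta> > 0" for \<delta>
    using hausdorff_premeasure_UN_eq_0 S_image_premeasure_eq_0[OF \<open>s > 0\<close> that] by metis
  then show "hausdorff_measure s (S ` {0..}) = 0"
    unfolding hausdorff_measure_def by (simp add: SUP_eq_const)
qed

theorem proposition1:
  shows "inj_on S {0..}
    \<and> mono_on {0..} S
    \<and> (\<forall>l\<ge>0. continuous (at_right l) S)
    \<and> S ` {0..} \<approx> (UNIV :: real set)
    \<and> hausdorff_dim (S ` {0..}) = 0
    \<and> totally_disconnected (S ` {0..})"
proof -
  have inj: "inj_on S {0..}"
    by (rule linorder_inj_onI') (use S_strict_mono in fastforce)
  have "(UNIV :: real set) \<lesssim> {0::real..}"
    \<comment> \<open>\<open>exp\<close> embeds the line into the half-line; with the inclusion,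
      Schroeder-Bernstein gives equal cardinality.\<close>
    unfolding lepoll_def by (rule exI[of _ exp]) (auto simp: inj_on_def)
  then have "{0::real..} \<approx> (UNIV :: real set)"
    by (intro lepoll_antisym) (auto intro: subset_imp_lepoll)
  then have "S ` {0..} \<approx> (UNIV :: real set)"
    using inj inj_on_image_eqpoll_self eqpoll_trans by blast
  then show ?thesis
    using inj S_mono S_right_continuous hausdorff_dim_S_image totally_disconnected_S_image
    by (auto intro: mono_onI)
qed

end
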